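(* For all $x\in(0,1)$, Rogers' dilogarithm satisfies \begin{align*} L_2(x)&=\frac{\zeta(2)}{2}+\frac{\zeta(2)}{2\pi}\left(\arctan\left(\frac{2x}{1-x^2}\right)-\frac{\pi}{2}\right)\\ &\quad-\int_0^{\frac{-x-1}{2x}}F\left(2\,\mathrm{arccot}\left(-t+\tfrac{1-x}{2x}\right),2\,\mathrm{arccot}\left(-t-\tfrac{1-x}{2x}\right)\right)dt\\ &\quad+\int_0^{\frac{x+1}{2}}F\left(2\,\mathrm{arccot}\left(-t+\tfrac{1-x}{2}\right),2\,\mathrm{arccot}\left(-t-\tfrac{1-x}{2}\right)\right)dt\\ &\quad-\int_0^{\frac12}F\left(2\,\mathrm{arccot}\left(-t+\tfrac12\right),2\,\mathrm{arccot}\left(-t-\tfrac12\right)\right)dt\\ &\quad+\int_0^{\frac x2}F\left(2\,\mathrm{arccot}\left(-t+\tfrac x2\right),2\,\mathrm{arccot}\left(-t-\tfrac x2\right)\right)dt, \end{align*} where for $0<\varphi_1<\varphi_2<2\pi$ \begin{align*} F(\varphi_1,\varphi_2)&=-\frac{\zeta(2)}{4\pi^2}\left((3\varphi_1-2\pi)(\cos\varphi_2-1)-(3\varphi_2-4\pi)(\cos\varphi_1-1)\right)\\ &\quad+\frac{3\zeta(2)}{2\pi^2}\left(\sin\varphi_1\cdot\log\left(\frac{\sin((\varphi_2-\varphi_1)/2)}{\sin(\varphi_1/2)}\right)-\sin\varphi_2\cdot\log\left(\frac{\sin((\varphi_2-\varphi_1)/2)}{\sin(\varphi_2/2)}\right)\right).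 \end{align*}
   Context: $L_2(x)=\frac12(\mathrm{Li}_2(x)-\mathrm{Li}_2(1-x)+\zeta(2))$ for $x\in(0,1)$, with $\mathrm{Li}_2(x)=\sum_{n\ge1}x^n/n^2$ and $\zeta(2)=\pi^2/6$. $\arctan$ is the principal branch with values in $(-\pi/2,\pi/2)$, and $\mathrm{arccot}:\mathbb{R}\to(0,\pi)$ is the inverse of $\cot$ on $(0,\pi)$ (so the two arguments of $F$ in each integrand satisfy $0<\varphi_1<\varphi_2<2\pi$). Integrals $\int_0^a$ with $a<0$ are oriented integrals. *)

theory Defs
  imports "HOL-Analysis.Analysis"
begin

definition Li2 :: "real \<Rightarrow> real" where
  "Li2 x = (\<Sum>n. x ^ Suc n / real (Suc n) ^ 2)"

definition zeta2 :: real where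
  "zeta2 = (\<Sum>n. 1 / real (Suc n) ^ 2)"

lemma zeta2_eq: "zeta2 = pi\<^sup>2 / 6"
  using sums_unique[OF inverse_squares_sums] by (simp add: zeta2_def add.commute)

definition rogers_L2 :: "real \<Rightarrow> real" where
  "rogers_L2 x = 1 / 2 * (Li2 x - Li2 (1 - x) + zeta2)"

definition arccot :: "real \<Rightarrow> real" where
  "arccot y = (THE \<phi>. 0 < \<phi> \<and> \<phi> < pi \<and> cot \<phi> = y)"

lemma arccot_eq: "arccot y = pi / 2 - arctan y"
  unfolding arccot_def
proof (rule the_equality)
  show "0 < pi / 2 - arctan y \<and> pi / 2 - arctan y < pi \<and> cot (pi / 2 - arctan y) = y"
  proof (intro conjI)
    have "cot (pi / 2 - arctan y) = tan (arctan y)"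
      by (simp add: cot_def tan_def sin_diff cos_diff)
    then show "cot (pi / 2 - arctan y) = y" by (simp only: tan_arctan)
  qed (use arctan_bounded[of y] in simp_all)
next
  fix \<phi> :: real assume \<phi>: "0 < \<phi> \<and> \<phi> < pi \<and> cot \<phi> = y"
  have "tan (pi / 2 - \<phi>) = y"
    using \<phi> by (simp add: cot_def tan_def sin_diff cos_diff)
  then have "arctan y = pi / 2 - \<phi>"
    using \<phi> by (intro arctan_unique) auto
  then show "\<phi> = pi / 2 - arctan y" by simp
qed

text \<open>The formula for \<open>F\<close> is meaningful only for \<open>0 < \<phi>\<^sub>1 < \<phi>\<^sub>2 < 2\<pi>\<close>;
  there all arguments of \<^const>\<open>ln\<close> are positive. The lemma
  \<open>arccot_args\<close> below shows that \<open>F\<close> is only used in that range.\<close>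

definition F :: "real \<Rightarrow> real \<Rightarrow> real" where
  "F \<phi>\<^sub>1 \<phi>\<^sub>2 =
     - (zeta2 / (4 * pi\<^sup>2)) *
         ((3 * \<phi>\<^sub>1 - 2 * pi) * (cos \<phi>\<^sub>2 - 1) - (3 * \<phi>\<^sub>2 - 4 * pi) * (cos \<phi>\<^sub>1 - 1))
     + 3 * zeta2 / (2 * pi\<^sup>2) *
         (sin \<phi>\<^sub>1 * ln (sin ((\<phi>\<^sub>2 - \<phi>\<^sub>1) / 2) / sin (\<phi>\<^sub>1 / 2))
          - sin \<phi>\<^sub>2 * ln (sin ((\<phi>\<^sub>2 - \<phi>\<^sub>1) / 2) / sin (\<phi>\<^sub>2 / 2)))"

lemma arccot_args:
  assumes "c > 0"
  shows "0 < 2 * arccot (- t + c)" "2 * arccot (- t + c) < 2 * arccot (- t - c)"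
    "2 * arccot (- t - c) < 2 * pi"
  using assms arctan_bounded[of "- t + c"] arctan_bounded[of "- t - c"]
    arctan_monotone[of "- t - c" "- t + c"]
  by (simp_all add: arccot_eq field_simps)

end

theory Submission
  imports Defs "HOL-Real_Asymp.Real_Asymp"
begin

text \<open>
  In the coordinates \<open>u = c - t\<close>, \<open>w = c + t\<close> each integrand \<open>F dt\<close> (with \<open>c\<close> held constant) is the
  restriction of a closed 1-form \<open>p(u, w) dw - p(w, u) du\<close> on the half plane \<open>u + w > 0\<close>: essentially
  the differential of the real part of Rogers' dilogarithm at \<open>(1 + i w) / (i (u + w))\<close>. The form
  vanishes along the diagonal \<open>t = 0\<close>, so \<open>\<integral>\<^sub>0\<^sup>a F dt\<close> is a potential of it, as a function of the
  endpoint \<open>(u, w) = (c - a, c + a)\<close>. The four integrals of the theorem have endpoints \<open>(1/x, -1)\<close>,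
  \<open>(-x, 1)\<close>, \<open>(0, 1)\<close> and \<open>(0, x)\<close>, along each of which one coordinate is constant; hence the
  derivative of the right-hand side in \<open>x\<close> is elementary and equals that of \<open>L\<^sub>2\<close>. Both sides
  extend continuously to \<open>x = 1\<close>, where they equal \<open>\<zeta>(2)\<close>.
\<close>

section \<open>The dilogarithm series on the unit interval\<close>

lemma Li2_0: "Li2 0 = 0"
  by (simp add: Li2_def)

lemma Li2_1: "Li2 1 = zeta2"
  by (simp add: Li2_def zeta2_def)

text \<open>Termwise differentiation cancels one factor \<open>Suc n\<close> and leaves the series
  of -ln (1 - x) divided by x.\<close>

lemma has_real_derivative_Li2:
  assumes "0 < x" "x < 1"
  shows "(Li2 has_real_derivative - ln (1 - x) / x) (at x)"
proof -
  let ?f = "\<lambda>n. 1 / (real (Suc n))\<^sup>2"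
  have eq: "?f n * real (Suc n) = 1 / real (Suc n)" for n
    by (simp add: power2_eq_square)
  have "summable (\<lambda>n. ?f n * real (Suc n) * y ^ n)" if "y \<in> {-1<..<1}" for y :: real
    unfolding eq
  proof (rule summable_comparison_test')
    show "summable (\<lambda>n. \<bar>y\<bar> ^ n)"
      using that by (intro summable_geometric) auto
    show "norm (1 / real (Suc n) * y ^ n) \<le> \<bar>y\<bar> ^ n" for n
      using mult_left_mono[of 1 "1 + real n" "\<bar>y\<bar> ^ n"]
      by (simp add: power_abs divide_simps abs_mult)
  qed
  then have "((\<lambda>x. \<Sum>n. ?f n * x ^ Suc n) has_real_derivative
      (\<Sum>n. ?f n * real (Suc n) * x ^ n)) (at x)"
    using assms by (intro DERIV_power_series'[where R = 1]) auto
  moreover have "(\<Sum>n. ?f n * real (Suc n) * x ^ n) = - ln (1 - x) / x"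
  proof -
    have "(\<lambda>n. - ((-(-x))^n) / of_nat n) sums ln (1 + (-x))"
      using assms by (intro ln_series') auto
    \<comment> \<open>The term of index 0 is a division by zero, hence 0, so the index shift does
      not change the sum.\<close>
    then have "(\<lambda>n. - (x ^ Suc n) / real (Suc n)) sums ln (1 - x)"
      by (subst sums_Suc_iff) simp
    then have "(\<lambda>n. (-1 / x) * (- (x ^ Suc n) / real (Suc n))) sums ((-1 / x) * ln (1 - x))"
      by (rule sums_mult)
    then have "(\<lambda>n. ?f n * real (Suc n) * x ^ n) sums (- ln (1 - x) / x)"
      unfolding eq using assms by (simp add: field_simps)
    then show ?thesis
      by (rule sums_unique[symmetric])
  qed
  ultimately show ?thesis
    unfolding Li2_def by simp
qed

text \<open>The summable bounds 1/(n+1)^2 make convergence uniform up to both endpoints, whose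
  values enter the comparison at x = 1.\<close>

lemma continuous_on_Li2: "continuous_on {0..1} Li2"
proof -
  have "uniform_limit {0..1} (\<lambda>n x. \<Sum>i<n. x ^ Suc i / (real (Suc i))\<^sup>2)
      (\<lambda>x. \<Sum>i. x ^ Suc i / (real (Suc i))\<^sup>2) sequentially"
  proof (rule Weierstrass_m_test)
    show "summable (\<lambda>n. 1 / (real (Suc n))\<^sup>2)"
      using sums_summable[OF inverse_squares_sums] by (simp add: add.commute)
    show "norm (x ^ Suc n / (real (Suc n))\<^sup>2) \<le> 1 / (real (Suc n))\<^sup>2" if "x \<in> {0..1}" for n x
      using that power_le_one[of x "Suc n"] by (simp add: divide_right_mono abs_mult)
  qed
  then show ?thesis
    unfolding Li2_def
    by (rule uniform_limit_theorem[rotated]) (auto intro!: always_eventually continuous_intros)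
qed

text \<open>The product is 0 at y = 0, which matches its one-sided limit. This makes the integrand
  continuous up to the line u + w = 0.\<close>

lemma continuous_on_mult_ln: "continuous_on {0..} (\<lambda>y::real. y * ln y)"
  unfolding continuous_on_eq_continuous_within
proof
  fix y :: real assume "y \<in> {0..}"
  show "continuous (at y within {0..}) (\<lambda>y. y * ln y)"
  proof (cases "y = 0")
    case True
    have "((\<lambda>y::real. y * ln y) \<longlongrightarrow> 0) (at_right 0)"
      by real_asymp
    then show ?thesis
      using True by (simp add: continuous_within at_within_Ici_at_right)
  qed (use \<open>y \<in> {0..}\<close> in \<open>auto intro!: continuous_intros\<close>)
qed

section \<open>The closed form and its partial derivatives\<close>

lemma one_plus_square_pos: "0 < 1 + (y::real)\<^sup>2"
  by (simp add: add_pos_nonneg)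

lemma one_plus_square_neq_0: "1 + (y::real)\<^sup>2 \<noteq> 0"
  using one_plus_square_pos[of y] by simp

text \<open>The coefficient \<open>p(u, w)\<close> of the closed form.\<close>

definition rogers_form :: "real \<Rightarrow> real \<Rightarrow> real" where
  "rogers_form u w = pi / 12 * (1 / (1 + w\<^sup>2))
     - 1 / 2 * (arctan u * (1 / (1 + w\<^sup>2)) + ln (1 + u\<^sup>2) / 2 * (w / (1 + w\<^sup>2)))
     + 1 / 2 * (ln (u + w) * (w / (1 + w\<^sup>2)))
     - (ln (1 + w\<^sup>2) / 2 - ln (1 + u\<^sup>2) / 2) / (2 * (u + w))"

text \<open>The partial derivative of p in its first slot, after cancellation. Its antisymmetry in
  \<open>u\<close> and \<open>w\<close> is exactly the closedness of p(u, w) dw - p(w, u)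
  du.\<close>

definition rogers_form_d1 :: "real \<Rightarrow> real \<Rightarrow> real" where
  "rogers_form_d1 u w = (ln (1 + w\<^sup>2) / 2 - ln (1 + u\<^sup>2) / 2) / (2 * (u + w)\<^sup>2)"

definition rogers_form_d2 :: "real \<Rightarrow> real \<Rightarrow> real" where
  "rogers_form_d2 u w = pi / 12 * (- 2 * w / (1 + w\<^sup>2)\<^sup>2)
     - 1 / 2 * (arctan u * (- 2 * w / (1 + w\<^sup>2)\<^sup>2) + ln (1 + u\<^sup>2) / 2 * ((1 - w\<^sup>2) / (1 + w\<^sup>2)\<^sup>2))
     + 1 / 2 * (ln (u + w) * ((1 - w\<^sup>2) / (1 + w\<^sup>2)\<^sup>2))
     + (ln (1 + w\<^sup>2) / 2 - ln (1 + u\<^sup>2) / 2) / (2 * (u + w)\<^sup>2)"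

text \<open>Stated along a curve (U, W), because it serves both for varying the endpoint of a
  segment and for moving along the segment.\<close>

lemma DERIV_rogers_form:
  fixes U W :: "real \<Rightarrow> real"
  assumes U: "(U has_real_derivative U') (at x within S)"
    and W: "(W has_real_derivative W') (at x within S)"
    and pos: "0 < U x + W x"
  shows "((\<lambda>x. rogers_form (U x) (W x)) has_real_derivative
    rogers_form_d1 (U x) (W x) * U' + rogers_form_d2 (U x) (W x) * W') (at x within S)"
proof -
  have 1: "((\<lambda>x. 1 / (1 + (W x)\<^sup>2)) has_real_derivative - 2 * W x / (1 + (W x)\<^sup>2)\<^sup>2 * W') (at x within S)"
    by (rule derivative_eq_intros W refl one_plus_square_neq_0)+
      (simp add: power2_eq_square)
  have 2: "((\<lambda>x. W x / (1 + (W x)\<^sup>2)) has_real_derivative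
      (1 - (W x)\<^sup>2) / (1 + (W x)\<^sup>2)\<^sup>2 * W') (at x within S)"
    by (rule derivative_eq_intros W refl one_plus_square_neq_0)+
      (simp add: power2_eq_square algebra_simps)
  have ln: "((\<lambda>x. ln (1 + (V x)\<^sup>2) / 2) has_real_derivative V x / (1 + (V x)\<^sup>2) * V') (at x within S)"
    if "(V has_real_derivative V') (at x within S)" for V V'
  proof -
    have "((\<lambda>x. ln (1 + (V x)\<^sup>2)) has_real_derivative 2 * (V x / (1 + (V x)\<^sup>2) * V')) (at x within S)"
      by (rule derivative_eq_intros that refl one_plus_square_pos)+ simp
    from DERIV_cdivide[OF this, of 2] show ?thesis
      by (rule DERIV_cong) (simp only: nonzero_mult_div_cancel_left[OF zero_neq_numeral[symmetric]])
  qed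
  have at: "((\<lambda>x. arctan (U x)) has_real_derivative 1 / (1 + (U x)\<^sup>2) * U') (at x within S)"
    using DERIV_chain2[OF DERIV_arctan U] by (simp add: inverse_eq_divide)
  have s: "((\<lambda>x. ln (U x + W x)) has_real_derivative 1 / (U x + W x) * (U' + W')) (at x within S)"
    by (rule derivative_eq_intros U W refl pos)+
  have q: "((\<lambda>x. (ln (1 + (W x)\<^sup>2) / 2 - ln (1 + (U x)\<^sup>2) / 2) / (2 * (U x + W x))) has_real_derivative
      (W x / (1 + (W x)\<^sup>2) * W' - U x / (1 + (U x)\<^sup>2) * U') / (2 * (U x + W x))
      - (ln (1 + (W x)\<^sup>2) / 2 - ln (1 + (U x)\<^sup>2) / 2) / (2 * (U x + W x)\<^sup>2) * (U' + W')) (at x within S)"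
  proof -
    have quot: "(N * (2 * y) - M * (2 * d)) / (2 * y * (2 * y)) = N / (2 * y) - M / (2 * y\<^sup>2) * d"
      if "y \<noteq> 0" for N M y d :: real
      using that by (simp add: field_simps power2_eq_square)
    from pos have "2 * (U x + W x) \<noteq> 0" by simp
    from DERIV_divide[OF DERIV_diff[OF ln[OF W] ln[OF U]] DERIV_cmult[OF DERIV_add[OF U W]] this]
    show ?thesis
      by (rule DERIV_cong) (use pos in \<open>simp only: quot\<close>)
  qed
  \<comment> \<open>The terms that differentiating arctan, the logarithms and the numerator of the
    quotient in \<open>u\<close> contributes. They cancel because u/(1+u^2) + w/(1+w^2) =
    (u+w)(1+uw)/((1+u^2)(1+w^2)).\<close>
  have key: "- 1 / 2 * (1 / (1 + u\<^sup>2) * (1 / (1 + w\<^sup>2)) + u / (1 + u\<^sup>2) * (w / (1 + w\<^sup>2)))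
      + 1 / 2 * (1 / (u + w) * (w / (1 + w\<^sup>2))) + u / (1 + u\<^sup>2) / (2 * (u + w)) = 0"
    if "0 < u + w" for u w :: real
  proof -
    have "1 + u\<^sup>2 \<noteq> 0" "1 + w\<^sup>2 \<noteq> 0" "u + w \<noteq> 0"
      using that one_plus_square_neq_0 by auto
    then show ?thesis
      by (simp add: divide_simps) (simp add: algebra_simps power2_eq_square)
  qed
  note D = DERIV_diff[OF DERIV_add[OF DERIV_diff[OF DERIV_cmult[OF 1, of "pi/12"]
    DERIV_cmult[OF DERIV_add[OF DERIV_mult[OF at 1] DERIV_mult[OF ln[OF U] 2]], of "1/2"]]
    DERIV_cmult[OF DERIV_mult[OF s 2], of "1/2"]] q]
  define u w where "u = U x" and "w = W x"
  \<comment> \<open>Naming the reciprocals turns the comparison of derivatives into a polynomial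
    identity, up to the multiple of \<open>U'\<close> that \<open>key\<close> makes zero.\<close>
  define r a b where "r = 1 / (u + w)" and "a = 1 / (1 + u\<^sup>2)" and "b = 1 / (1 + w\<^sup>2)"
  have to_mult: "y / (2 * (u + w)) = y * r / 2" "y / (2 * (u + w)\<^sup>2) = y * r\<^sup>2 / 2"
    "y / (u + w) = y * r" "y / (1 + u\<^sup>2) = y * a" "y / (1 + w\<^sup>2) = y * b"
    "y / (1 + w\<^sup>2)\<^sup>2 = y * b\<^sup>2" for y
    by (simp_all add: r_def a_def b_def power_divide)
  have "U' * (- 1 / 2 * (a * b + u * a * (w * b)) + 1 / 2 * (r * (w * b)) + u * a * r / 2) = 0"
    using key[of u w] pos unfolding to_mult by (simp add: u_def w_def)
  then show ?thesis
    unfolding rogers_form_def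
    by (intro DERIV_cong[OF D])
      (simp only: rogers_form_d1_def rogers_form_d2_def u_def[symmetric] w_def[symmetric] to_mult,
        simp add: algebra_simps power2_eq_square add_divide_distrib diff_divide_distrib)
qed

lemma continuous_on_rogers_form:
  assumes "continuous_on S f" "continuous_on S g" "\<And>z. z \<in> S \<Longrightarrow> 0 < f z + g z"
  shows "continuous_on S (\<lambda>z. rogers_form (f z) (g z))"
    "continuous_on S (\<lambda>z. rogers_form_d1 (f z) (g z))"
    "continuous_on S (\<lambda>z. rogers_form_d2 (f z) (g z))"
proof -
  have "f z + g z \<noteq> 0" "2 * f z + 2 * g z \<noteq> 0" if "z \<in> S" for z
    using assms(3)[OF that] by linarith+
  note this[simp] one_plus_square_neq_0[simp]
  show "continuous_on S (\<lambda>z. rogers_form (f z) (g z))"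
    unfolding rogers_form_def by (intro continuous_intros assms(1,2) ballI) simp_all
  show "continuous_on S (\<lambda>z. rogers_form_d1 (f z) (g z))"
    unfolding rogers_form_d1_def by (intro continuous_intros assms(1,2) ballI) simp_all
  show "continuous_on S (\<lambda>z. rogers_form_d2 (f z) (g z))"
    unfolding rogers_form_d2_def by (intro continuous_intros assms(1,2) ballI) simp_all
qed

section \<open>The integrand in the coordinates u, w\<close>

text \<open>The logarithmic term is written with \<open>(u + w) * ln (u + w)\<close>, so that the integrand is
  continuous up to the line \<open>u + w = 0\<close>.\<close>

definition rogers_integrand :: "real \<Rightarrow> real \<Rightarrow> real" where
  "rogers_integrand u w = pi / 12 * (1 / (1 + w\<^sup>2) + 1 / (1 + u\<^sup>2))
     - 1 / 2 * (arctan u * (1 / (1 + w\<^sup>2)) + arctan w * (1 / (1 + u\<^sup>2)))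
     - 1 / 2 * (ln (1 + u\<^sup>2) / 2 * (w / (1 + w\<^sup>2)) + ln (1 + w\<^sup>2) / 2 * (u / (1 + u\<^sup>2)))
     + 1 / 2 * ((u + w) * ln (u + w)) * ((1 + u * w) / ((1 + u\<^sup>2) * (1 + w\<^sup>2)))"

lemma rogers_integrand_commute: "rogers_integrand u w = rogers_integrand w u"
  by (simp add: rogers_integrand_def algebra_simps)

lemma rogers_integrand_log_term:
  "1 / 2 * ((u + w) * ln (u + w)) * ((1 + u * w) / ((1 + u\<^sup>2) * (1 + w\<^sup>2)))
    = 1 / 2 * ln (u + w) * (u / (1 + u\<^sup>2) + w / (1 + w\<^sup>2))"
  for u w :: real
proof -
  have "u / (1 + u\<^sup>2) + w / (1 + w\<^sup>2) = (u + w) * ((1 + u * w) / ((1 + u\<^sup>2) * (1 + w\<^sup>2)))"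
    using one_plus_square_neq_0[of u] one_plus_square_neq_0[of w]
    by (simp add: divide_simps) (simp add: algebra_simps power2_eq_square)
  then show ?thesis by simp
qed

text \<open>With c constant, du = -dt and dw = dt, so the form restricts to (p(u, w) + p(w, u)) dt.
  The difference quotients are antisymmetric and cancel.\<close>

lemma rogers_integrand_eq_form:
  "rogers_integrand u w = rogers_form u w + rogers_form w u"
proof -
  have "(ln (1 + u\<^sup>2) / 2 - ln (1 + w\<^sup>2) / 2) / (2 * (w + u))
      = - ((ln (1 + w\<^sup>2) / 2 - ln (1 + u\<^sup>2) / 2) / (2 * (u + w)))"
    by (simp add: add.commute minus_divide_left)
  then show ?thesis
    unfolding rogers_integrand_def rogers_form_def rogers_integrand_log_term
    by (simp only: add.commute[of w u]) (simp add: ring_distribs)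
qed

lemma continuous_on_rogers_integrand:
  assumes "continuous_on S f" "continuous_on S g" "\<And>z. z \<in> S \<Longrightarrow> 0 \<le> f z + g z"
  shows "continuous_on S (\<lambda>z. rogers_integrand (f z) (g z))"
proof -
  have "continuous_on S (\<lambda>z. (f z + g z) * ln (f z + g z))"
    by (rule continuous_on_compose2[OF continuous_on_mult_ln]) (auto intro!: continuous_intros assms)
  moreover have "continuous_on S (\<lambda>z. pi / 12 * (1 / (1 + (g z)\<^sup>2) + 1 / (1 + (f z)\<^sup>2))
     - 1 / 2 * (arctan (f z) * (1 / (1 + (g z)\<^sup>2)) + arctan (g z) * (1 / (1 + (f z)\<^sup>2)))
     - 1 / 2 * (ln (1 + (f z)\<^sup>2) / 2 * (g z / (1 + (g z)\<^sup>2)) + ln (1 + (g z)\<^sup>2) / 2 * (f z / (1 + (f z)\<^sup>2)))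
     + 1 / 2 * h z * ((1 + f z * g z) / ((1 + (f z)\<^sup>2) * (1 + (g z)\<^sup>2))))"
    if "continuous_on S h" for h
    by (intro continuous_intros assms(1,2) that ballI) (simp_all add: one_plus_square_neq_0)
  ultimately show ?thesis
    unfolding rogers_integrand_def by blast
qed

text \<open>The angles are pi - 2 arctan u and pi + 2 arctan w. Double-angle formulas make their
  sines and cosines rational in u and w, and the square roots in the half-angle sines become halved
  logarithms.\<close>

lemma F_arccot:
  assumes "0 < c"
  shows "F (2 * arccot (- t + c)) (2 * arccot (- t - c)) = rogers_integrand (c - t) (c + t)"
proof -
  define u w where "u = c - t" and "w = c + t"
  have c: "2 * c = u + w" and pos: "0 < u + w"
    using assms by (auto simp: u_def w_def)
  have args: "2 * arccot (- t + c) = pi - 2 * arctan u" "2 * arccot (- t - c) = pi + 2 * arctan w"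
    using arctan_minus[of "c + t"] by (simp_all add: arccot_eq u_def w_def minus_diff_commute)
  have sq: "0 < 1 + u\<^sup>2" "0 < 1 + w\<^sup>2"
    by (rule one_plus_square_pos)+
  have cos: "cos (2 * arctan y) = 2 / (1 + y\<^sup>2) - 1" and sin: "sin (2 * arctan y) = 2 * (y / (1 + y\<^sup>2))" for y
    using one_plus_square_pos[of y]
    by (simp_all add: cos_double_cos sin_double cos_arctan sin_arctan power_divide)
  have half: "(pi - 2 * arctan u) / 2 = pi / 2 - arctan u" "(pi + 2 * arctan w) / 2 = pi / 2 + arctan w"
    "(pi + 2 * arctan w - (pi - 2 * arctan u)) / 2 = arctan u + arctan w"
    by simp_all
  have sin_half: "sin (pi / 2 - arctan u) = 1 / sqrt (1 + u\<^sup>2)"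
    "sin (pi / 2 + arctan w) = 1 / sqrt (1 + w\<^sup>2)"
    "sin (arctan u + arctan w) = (u + w) / (sqrt (1 + u\<^sup>2) * sqrt (1 + w\<^sup>2))"
    by (simp_all add: sin_diff sin_add cos_arctan sin_arctan add_divide_distrib)
  have ln: "ln ((u + w) / (sqrt (1 + u\<^sup>2) * sqrt (1 + w\<^sup>2)) / (1 / sqrt (1 + u\<^sup>2)))
      = ln (u + w) - ln (1 + w\<^sup>2) / 2"
    "ln ((u + w) / (sqrt (1 + u\<^sup>2) * sqrt (1 + w\<^sup>2)) / (1 / sqrt (1 + w\<^sup>2)))
      = ln (u + w) - ln (1 + u\<^sup>2) / 2"
    using sq pos by (simp_all add: ln_div ln_sqrt)
  have trig: "cos (pi - 2 * arctan u) = 1 - 2 / (1 + u\<^sup>2)" "cos (pi + 2 * arctan w) = 1 - 2 / (1 + w\<^sup>2)"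
    "sin (pi - 2 * arctan u) = 2 * (u / (1 + u\<^sup>2))" "sin (pi + 2 * arctan w) = - (2 * (w / (1 + w\<^sup>2)))"
    by (simp_all add: cos_diff sin_diff cos_add sin_add cos sin)
  have zeta: "zeta2 / (4 * pi\<^sup>2) = 1 / 24" "3 * zeta2 / (2 * pi\<^sup>2) = 1 / 4"
    by (simp_all add: zeta2_eq)
  define a b where "a = 1 / (1 + u\<^sup>2)" and "b = 1 / (1 + w\<^sup>2)"
  have to_mult: "y / (1 + u\<^sup>2) = y * a" "y / (1 + w\<^sup>2) = y * b" for y
    by (simp_all add: a_def b_def)
  have "F (2 * arccot (- t + c)) (2 * arccot (- t - c)) = rogers_integrand u w"
    unfolding F_def args half sin_half ln trig zeta rogers_integrand_def rogers_integrand_log_term to_mult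
    by (simp add: algebra_simps add_divide_distrib)
  then show ?thesis by (simp add: u_def w_def)
qed

section \<open>The potential and its derivative\<close>

text \<open>The integral \<open>\<integral>\<^sub>0\<^sup>a F dt\<close>, rescaled to \<open>{0..1}\<close>, with \<open>a = (w - u) / 2\<close> and
  \<open>c = (u + w) / 2\<close>.\<close>

definition rogers_potential :: "real \<Rightarrow> real \<Rightarrow> real" where
  "rogers_potential u w = integral {0..1} (\<lambda>s. (w - u) / 2 *
     rogers_integrand ((u + w) / 2 - s * ((w - u) / 2)) ((u + w) / 2 + s * ((w - u) / 2)))"

text \<open>The integrand is symmetric and the path is reversed. This allows the constant coordinate
  of each endpoint to be put first, the slot that the derivative below keeps fixed.\<close>

lemma rogers_potential_swap: "rogers_potential w u = - rogers_potential u w"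
proof -
  have "(u - w) / 2 * rogers_integrand ((w + u) / 2 - s * ((u - w) / 2)) ((w + u) / 2 + s * ((u - w) / 2))
    = - ((w - u) / 2 * rogers_integrand ((u + w) / 2 - s * ((w - u) / 2)) ((u + w) / 2 + s * ((w - u) / 2)))" for s
    by (subst rogers_integrand_commute) (simp add: field_simps)
  then show ?thesis
    unfolding rogers_potential_def by simp
qed

lemma continuous_on_rogers_potential: "continuous_on {-u..} (rogers_potential u)"
  unfolding rogers_potential_def cbox_interval[symmetric]
  by (rule integral_continuous_on_param)
    (auto simp: case_prod_unfold field_simps intro!: continuous_intros continuous_on_rogers_integrand)

text \<open>The Poincare lemma by hand: differentiate under the integral sign, then recognise the
  new integrand \<open>D\<close> as an s-derivative.\<close>

lemma DERIV_rogers_potential: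
  assumes "0 < u + w"
  shows "(rogers_potential u has_real_derivative rogers_form u w) (at w)"
proof -
  \<comment> \<open>The segment from the diagonal point with both coordinates (u+w)/2 to (u, w). The
    coordinate sum is constant on it, so it stays in the half plane.\<close>
  define U where "U = (\<lambda>w s. (u + w) / 2 - s * ((w - u) / 2))"
  define W where "W = (\<lambda>w s. (u + w) / 2 + s * ((w - u) / 2))"
  have add: "U w s + W w s = u + w" "W w s + U w s = u + w" for w s
    by (simp_all add: U_def W_def)
  define D where "D = (\<lambda>w s. 1 / 2 * (rogers_form (U w s) (W w s) + rogers_form (W w s) (U w s))
    + (w - u) / 2 * ((rogers_form_d1 (U w s) (W w s) * ((1 - s) / 2) + rogers_form_d2 (U w s) (W w s) * ((1 + s) / 2))
      + (rogers_form_d1 (W w s) (U w s) * ((1 + s) / 2) + rogers_form_d2 (W w s) (U w s) * ((1 - s) / 2))))"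
  \<comment> \<open>The form evaluated on the variation of the segment in \<open>w\<close>, which
    has components (1-s)/2 and (1+s)/2. At s = 0 the point is on the diagonal and both terms agree;
    at s = 1 only p(u, w) survives.\<close>
  define P where "P = (\<lambda>s. (1 + s) / 2 * rogers_form (U w s) (W w s) - (1 - s) / 2 * rogers_form (W w s) (U w s))"
  have "((\<lambda>w. integral (cbox 0 1) (\<lambda>s. (w - u) / 2 * rogers_integrand (U w s) (W w s)))
      has_real_derivative integral (cbox 0 1) (D w)) (at w within {-u<..})"
  proof (rule leibniz_rule_field_derivative)
    fix w s assume w: "w \<in> {-u<..}"
    have dU: "((\<lambda>w. U w s) has_real_derivative (1 - s) / 2) (at w within {-u<..})"
      unfolding U_def by (auto intro!: derivative_eq_intros simp: field_simps)
    have dW: "((\<lambda>w. W w s) has_real_derivative (1 + s) / 2) (at w within {-u<..})"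
      unfolding W_def by (auto intro!: derivative_eq_intros simp: field_simps)
    have "((\<lambda>w. (w - u) / 2) has_real_derivative 1 / 2) (at w within {-u<..})"
      by (auto intro!: derivative_eq_intros)
    from DERIV_mult[OF this DERIV_add[OF DERIV_rogers_form[OF dU dW] DERIV_rogers_form[OF dW dU]]]
    show "((\<lambda>w. (w - u) / 2 * rogers_integrand (U w s) (W w s)) has_real_derivative D w s) (at w within {-u<..})"
      unfolding rogers_integrand_eq_form D_def using w by (simp add: add algebra_simps)
  next
    fix w assume "w \<in> {-u<..}"
    then show "(\<lambda>s. (w - u) / 2 * rogers_integrand (U w s) (W w s)) integrable_on cbox 0 1"
      by (intro integrable_continuous continuous_intros continuous_on_rogers_integrand)
        (auto simp: add U_def W_def intro!: continuous_intros)
  next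
    show "continuous_on ({-u<..} \<times> cbox 0 1) (\<lambda>(w, s). D w s)"
      unfolding D_def case_prod_unfold
      by (intro continuous_intros continuous_on_rogers_form)
        (auto simp: add, auto simp: U_def W_def intro!: continuous_intros)
  qed (use assms in auto)
  moreover have "(D w has_integral P 1 - P 0) {0..1}"
  proof (rule fundamental_theorem_of_calculus)
    fix s :: real assume "s \<in> {0..1}"
    have dU: "((\<lambda>s. U w s) has_real_derivative - ((w - u) / 2)) (at s within {0..1})"
      unfolding U_def by (auto intro!: derivative_eq_intros)
    have dW: "((\<lambda>s. W w s) has_real_derivative (w - u) / 2) (at s within {0..1})"
      unfolding W_def by (auto intro!: derivative_eq_intros)
    have dp: "((\<lambda>s. (1 + s) / 2) has_real_derivative 1 / 2) (at s within {0..1})"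
      and dm: "((\<lambda>s. (1 - s) / 2) has_real_derivative - 1 / 2) (at s within {0..1})"
      by (auto intro!: derivative_eq_intros)
    \<comment> \<open>closedness of the form\<close>
    have anti: "rogers_form_d1 (W w s) (U w s) = - rogers_form_d1 (U w s) (W w s)"
      by (simp add: rogers_form_d1_def add minus_divide_left)
    have "(P has_real_derivative D w s) (at s within {0..1})"
      unfolding P_def
    proof (rule DERIV_cong[OF DERIV_diff[OF DERIV_mult[OF dp DERIV_rogers_form[OF dU dW]]
        DERIV_mult[OF dm DERIV_rogers_form[OF dW dU]]]])
    qed (use assms in \<open>simp_all add: add D_def anti field_simps\<close>)
    then show "(P has_vector_derivative D w s) (at s within {0..1})"
      by (simp add: has_real_derivative_iff_has_vector_derivative)
  qed simp
  moreover have "P 1 = rogers_form u w" "P 0 = 0"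
    by (simp_all add: P_def U_def W_def field_simps)
  ultimately show ?thesis
    using assms unfolding rogers_potential_def U_def W_def
    by (simp add: at_within_open[of w "{-u<..}"] integral_unique)
qed

text \<open>The substitution t = a s moves the oriented integral to {0..1} for either sign of
  \<open>a\<close>.\<close>

lemma interval_integral_F:
  assumes "0 < c"
  shows "(LBINT t=ereal 0..ereal a. F (2 * arccot (- t + c)) (2 * arccot (- t - c)))
    = rogers_potential (c - a) (c + a)"
proof -
  let ?f = "\<lambda>t. rogers_integrand (c - t) (c + t)"
  have cont: "continuous_on S ?f" for S
    using assms by (intro continuous_on_rogers_integrand continuous_intros) auto
  have "(LBINT t=ereal 0..ereal a. F (2 * arccot (- t + c)) (2 * arccot (- t - c)))
      = (LBINT t=ereal (a * 0)..ereal (a * 1). ?f t)"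
    unfolding F_arccot[OF assms] by simp
  also have "\<dots> = (LBINT s=ereal 0..ereal 1. a *\<^sub>R ?f (a * s))"
    by (rule interval_integral_substitution_finite[symmetric])
      (auto intro!: derivative_eq_intros cont)
  also have "\<dots> = integral {0..1} (\<lambda>s. a *\<^sub>R ?f (a * s))"
    by (rule interval_integral_eq_integral)
      (auto intro!: borel_integrable_atLeastAtMost' continuous_intros continuous_on_compose2[OF cont])
  also have "\<dots> = rogers_potential (c - a) (c + a)"
    by (simp add: rogers_potential_def mult.commute)
  finally show ?thesis .
qed

text \<open>On u + w = 0 the arctan and logarithm terms cancel, and the integrand collapses to
  (pi/6)/(1+s^2).\<close>

lemma rogers_potential_boundary: "rogers_potential (-1) 1 = pi\<^sup>2 / 24"
proof -
  have "((\<lambda>s. pi / 6 * arctan s) has_vector_derivative rogers_integrand (- s) s) (at s within {0..1})" for s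
    unfolding has_real_derivative_iff_has_vector_derivative[symmetric]
    by (rule has_field_derivative_at_within, rule DERIV_cong[OF DERIV_cmult[OF DERIV_arctan[of s], of "pi / 6"]])
      (simp add: rogers_integrand_def arctan_minus inverse_eq_divide)
  then have "((\<lambda>s. rogers_integrand (- s) s) has_integral pi / 6 * arctan 1 - pi / 6 * arctan 0) {0..1}"
    by (intro fundamental_theorem_of_calculus) auto
  then show ?thesis
    by (simp add: rogers_potential_def integral_unique arctan_one power2_eq_square)
qed

section \<open>Comparison of derivatives and of the values at x = 1\<close>

lemma DERIV_rogers_L2:
  assumes "0 < x" "x < 1"
  shows "(rogers_L2 has_real_derivative - (ln (1 - x) / x + ln x / (1 - x)) / 2) (at x)"
proof -
  have "((\<lambda>x. Li2 (1 - x)) has_real_derivative - ln (1 - (1 - x)) / (1 - x) * (- 1)) (at x)"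
    using assms by (intro DERIV_chain'[OF _ has_real_derivative_Li2]) (auto intro!: derivative_eq_intros)
  from DERIV_cmult[OF DERIV_add[OF DERIV_diff[OF has_real_derivative_Li2[OF assms] this] DERIV_const], of "1 / 2" zeta2]
  show ?thesis
    unfolding rogers_L2_def by (rule DERIV_cong) simp
qed

text \<open>The left side is the derivative of the right-hand side of the theorem. Here
  \<open>arctan\<close> is taken only at -1, 1 and 0, so the terms in pi, ln 2 and ln (1+x^2) each
  cancel.\<close>

lemma rogers_form_sum:
  assumes "0 < x" "x < 1"
  shows "pi / 6 * (1 / (1 + x\<^sup>2)) - rogers_form (- 1) (1 / x) / x\<^sup>2 + rogers_form 1 (- x) + rogers_form 0 x
    = - (ln (1 - x) / x + ln x / (1 - x)) / 2"
proof -
  have x: "x \<noteq> 0" "1 - x \<noteq> 0" "1 + x\<^sup>2 \<noteq> 0" "0 < 1 + x\<^sup>2"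
    using assms one_plus_square_pos[of x] by auto
  have inv: "1 + (1 / x)\<^sup>2 = (1 + x\<^sup>2) / x\<^sup>2" "- 1 + 1 / x = (1 - x) / x"
    using x by (simp_all add: field_simps)
  have ln: "ln ((1 + x\<^sup>2) / x\<^sup>2) = ln (1 + x\<^sup>2) - 2 * ln x" "ln ((1 - x) / x) = ln (1 - x) - ln x"
    using assms x by (simp_all add: ln_div ln_realpow)
  have p: "rogers_form (- 1) (1 / x) / x\<^sup>2 = pi / 12 / (1 + x\<^sup>2) + pi / 8 / (1 + x\<^sup>2)
      - ln 2 / 4 / (x * (1 + x\<^sup>2)) + (ln (1 - x) - ln x) / 2 / (x * (1 + x\<^sup>2))
      - (ln (1 + x\<^sup>2) / 2 - ln x - ln 2 / 2) / (2 * (x * (1 - x)))"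
    using x unfolding rogers_form_def inv ln
    by (simp add: arctan_minus arctan_one divide_simps) (simp add: algebra_simps power2_eq_square)
  have q: "rogers_form 1 (- x) = pi / 12 / (1 + x\<^sup>2) - pi / 8 / (1 + x\<^sup>2) + ln 2 / 4 * x / (1 + x\<^sup>2)
      - ln (1 - x) / 2 * x / (1 + x\<^sup>2) - (ln (1 + x\<^sup>2) / 2 - ln 2 / 2) / (2 * (1 - x))"
  proof -
    define a c where "a = 1 / (1 + x\<^sup>2)" and "c = 1 / (2 * (1 - x))"
    have to_mult: "y / (1 + x\<^sup>2) = y * a" "y / (2 * (1 - x)) = y * c" for y
      by (simp_all add: a_def c_def)
    show ?thesis
      unfolding rogers_form_def power2_minus add_uminus_conv_diff to_mult
      by (simp add: arctan_one algebra_simps)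
  qed
  have r: "rogers_form 0 x = pi / 12 / (1 + x\<^sup>2) + ln x / 2 * x / (1 + x\<^sup>2) - ln (1 + x\<^sup>2) / (4 * x)"
    unfolding rogers_form_def by simp
  show ?thesis
    unfolding p q r using x(1-3)
    by (simp add: divide_simps) (simp add: algebra_simps power2_eq_square)
qed

theorem theorem5p6:
  fixes x :: real
  assumes "0 < x" and "x < 1"
  shows "rogers_L2 x =
      zeta2 / 2 + zeta2 / (2 * pi) * (arctan (2 * x / (1 - x\<^sup>2)) - pi / 2)
      - (LBINT t=ereal 0..ereal ((- x - 1) / (2 * x)).
           F (2 * arccot (- t + (1 - x) / (2 * x))) (2 * arccot (- t - (1 - x) / (2 * x))))
      + (LBINT t=ereal 0..ereal ((x + 1) / 2).
           F (2 * arccot (- t + (1 - x) / 2)) (2 * arccot (- t - (1 - x) / 2)))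
      - (LBINT t=ereal 0..ereal (1 / 2).
           F (2 * arccot (- t + 1 / 2)) (2 * arccot (- t - 1 / 2)))
      + (LBINT t=ereal 0..ereal (x / 2).
           F (2 * arccot (- t + x / 2)) (2 * arccot (- t - x / 2)))"
proof -
  \<comment> \<open>Potentials replace the integrals; the first two are swapped, which flips their
    signs, so that only the second argument depends on x.\<close>
  define S where "S = (\<lambda>x. pi\<^sup>2 / 12 + pi / 12 * (2 * arctan x - pi / 2) + rogers_potential (- 1) (1 / x)
    - rogers_potential 1 (- x) - rogers_potential 0 1 + rogers_potential 0 x)"
  have deriv: "(S has_real_derivative - (ln (1 - y) / y + ln y / (1 - y)) / 2) (at y)"
    if y: "0 < y" "y < 1" for y
  proof -
    have "((\<lambda>x. 1 / x) has_real_derivative - (1 / y\<^sup>2)) (at y)"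
      using y by (auto intro!: derivative_eq_intros simp: power2_eq_square)
    then have 1: "((\<lambda>x. rogers_potential (- 1) (1 / x)) has_real_derivative
        rogers_form (- 1) (1 / y) * - (1 / y\<^sup>2)) (at y)"
      using y by (intro DERIV_chain'[OF _ DERIV_rogers_potential]) auto
    have "((\<lambda>x::real. - x) has_real_derivative - 1) (at y)"
      by (auto intro!: derivative_eq_intros)
    then have 2: "((\<lambda>x. rogers_potential 1 (- x)) has_real_derivative rogers_form 1 (- y) * - 1) (at y)"
      using y by (intro DERIV_chain'[OF _ DERIV_rogers_potential]) auto
    have 3: "(rogers_potential 0 has_real_derivative rogers_form 0 y) (at y)"
      using y by (intro DERIV_rogers_potential) auto
    have 4: "((\<lambda>x. pi\<^sup>2 / 12 + pi / 12 * (2 * arctan x - pi / 2)) has_real_derivative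
        pi / 6 * (1 / (1 + y\<^sup>2))) (at y)"
      using DERIV_add[OF DERIV_const[of "pi\<^sup>2 / 12"] DERIV_cmult[OF DERIV_diff[OF
            DERIV_cmult[OF DERIV_arctan[of y], of 2] DERIV_const[of "pi / 2"]], of "pi / 12"]]
      by (rule DERIV_cong) (simp add: inverse_eq_divide)
    from DERIV_add[OF DERIV_diff[OF DERIV_diff[OF DERIV_add[OF 4 1] 2] DERIV_const] 3] show ?thesis
      unfolding S_def by (rule DERIV_cong) (subst rogers_form_sum[OF y, symmetric], simp)
  qed
  \<comment> \<open>At x = 1 these two potentials reach (-1, 1) and (1, -1) on the line u + w = 0,
    outside the range of the derivative lemma; continuity takes over there.\<close>
  have "continuous_on {x..1} (\<lambda>x. rogers_potential (- 1) (1 / x))"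
    "continuous_on {x..1} (\<lambda>x. rogers_potential 1 (- x))"
    using assms by (auto intro!: continuous_intros continuous_on_compose2[OF continuous_on_rogers_potential])
  moreover have "continuous_on {x..1} (rogers_potential 0)"
    using assms by (auto intro: continuous_on_subset[OF continuous_on_rogers_potential])
  ultimately have "continuous_on {x..1} S"
    unfolding S_def by (intro continuous_intros)
  moreover have "continuous_on {x..1} rogers_L2"
    unfolding rogers_L2_def using assms
    by (auto intro!: continuous_intros continuous_on_compose2[OF continuous_on_Li2])
  ultimately have "continuous_on {x..1} (\<lambda>y. rogers_L2 y - S y)"
    by (intro continuous_intros)
  then have "rogers_L2 1 - S 1 = rogers_L2 x - S x"
    using DERIV_diff[OF DERIV_rogers_L2 deriv] assms by (intro DERIV_isconst_end) auto
  \<comment> \<open>The potentials at (0, 1) and (0, x) cancel at x = 1, and the first two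
    contribute pi^2/24 each.\<close>
  moreover have "rogers_L2 1 = S 1"
    using rogers_potential_swap[of 1 "- 1"]
    by (simp add: rogers_L2_def S_def Li2_0 Li2_1 zeta2_eq arctan_one rogers_potential_boundary
        power2_eq_square)
  ultimately have L2: "rogers_L2 x = S x"
    by simp
  have c: "0 < (1 - x) / (2 * x)" "0 < (1 - x) / 2" "0 < x / 2" "(0::real) < 1 / 2"
    using assms by auto
  have ends: "(1 - x) / (2 * x) - (- x - 1) / (2 * x) = 1 / x" "(1 - x) / (2 * x) + (- x - 1) / (2 * x) = - 1"
    "(1 - x) / 2 - (x + 1) / 2 = - x" "(1 - x) / 2 + (x + 1) / 2 = 1"
    using assms by (simp_all add: field_simps)
  \<comment> \<open>No branch correction arises in the doubling formula, since |x| < 1.\<close>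
  have at: "arctan (2 * x / (1 - x\<^sup>2)) = 2 * arctan x"
    using assms by (subst arctan_double) auto
  have zeta: "zeta2 / (2 * pi) = pi / 12" "zeta2 / 2 = pi\<^sup>2 / 12"
    by (simp_all add: zeta2_eq power2_eq_square)
  show ?thesis
    unfolding L2 S_def interval_integral_F[OF c(1)] interval_integral_F[OF c(2)]
      interval_integral_F[OF c(3)] interval_integral_F[OF c(4)] ends at zeta
    using rogers_potential_swap[of "1 / x" "- 1"] rogers_potential_swap[of 1 "- x"] by simp
qed

end
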